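(* Let $X_1,\dots,X_n$ be independent continuous real-valued random variables, $\mathbf{X}=(X_1,\dots,X_n)$, let $T=T(X_1,\dots,X_n)$ be a continuous random variable with a density $f_T$ (with $T$ a measurable function on $\mathbb{R}^n$), let $t\in\mathrm{range}(T)$, $E=\{T=t\}$, and let $I\subset\{1,\dots,n\}$ be an index set. Assume (DSH), (A1) and (A2) from the context. Then the following algorithm samples from the distribution $\mathcal{L}\big((X_1,\dots,X_n)\mid T=t\big)$: 1. Sample from $\mathcal{L}(X^{(I)})$; denote the observation by $x^{(I)}$. Independently sample $u$ uniformly from $(0,1)$. 2. If $x^{(I)}\in E^{(I)}$ and $u<\dfrac{f_{T_I|x^{(I)}}\big(t_I(x^{(I)})\big)}{\sup_{\ell\in E^{(I)}} f_{T_I|\ell}\big(t_I(\ell)\big)}$, return $\sigma_I(x^{(I)},y_I)$, where $y_I=y_I(x^{(I)})$; otherwise restart (with fresh independent randomness).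
   Context: Write $[n]=\{1,\dots,n\}$ and $i=|I|$. "Continuous" means having a density with respect to Lebesgue measure on the Euclidean space in which the variable takes values. Identify the event $E$ with the set $\{z\in\mathbb{R}^n:T(z)=t\}$. $X_I=(X_j)_{j\in I}\in\mathbb{R}^{i}$ and $X^{(I)}=(X_j)_{j\in[n]\setminus I}\in\mathbb{R}^{n-i}$. $\sigma_I:\mathbb{R}^{n-i}\times\mathbb{R}^{i}\to\mathbb{R}^n$ places the entries of its second argument in the coordinates indexed by $I$ and the entries of its first argument, in order, in the remaining coordinates, so that $\sigma_I(X^{(I)},X_I)=\mathbf{X}$. The $I$-completable set is $E^{(I)}=\{x\in\mathbb{R}^{n-i}:\exists\,y\in\mathbb{R}^i,\ \sigma_I(x,y)\in E\}$. (DSH), deterministic second half: for each $x\in E^{(I)}$ there is exactly one $y\in\mathbb{R}^i$ with $\sigma_I(x,y)\in E$; this unique completion is denoted $y_I(x)$. For $x\in\mathbb{R}^{n-i}$, $T_I$ given $x$ is the random variable $T(\sigma_I(x,X_I))$; it is assumed to have a density, denoted $f_{T_I|x}$ and chosen jointly measurable in $(x,s)$. For $x\in E^{(I)}$, $t_I(x):=T(\sigma_I(x,y_I(x)))$ (which equals $t$). Put $q(x)=f_{T_I|x}(t_I(x))$ for $x\in E^{(I)}$ and $q(x)=0$ otherwise. (A1): $0<\sup_x q(x)<\infty$. (A2): $\mathbb{P}(q(X^{(I)})>0)>0$. The conditional distribution $\mathcal{L}(\mathbf{X}\mid T=t)$ is the member $\mathbb{P}_t$ of the disintegration of $\mathbb{P}=\mathcal{L}(\mathbf{X})$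 with respect to $T$ and the law $T\mathbb{P}$ of $T$: a family of probability measures $\mathbb{P}_t$ with $\mathbb{P}_t\{T\neq t\}=0$ for $T\mathbb{P}$-almost every $t$, $t\mapsto\int f\,d\mathbb{P}_t$ measurable, and $\int f\,d\mathbb{P}=\int\left(\int f\,d\mathbb{P}_t\right)(T\mathbb{P})(dt)$ for all nonnegative measurable $f$. It is unique up to $T\mathbb{P}$-null sets of $t$, and the statement is accordingly understood for all $t$ satisfying the assumptions outside some $T\mathbb{P}$-null set. "Samples from" means exact sampling: the algorithm terminates in finite time with probability 1 and its output has exactly the stated distribution. *)

theory Defs
  imports "HOL-Probability.Probability"
begin

text \<open>
  A vector with coordinates indexed by a finite set \<open>A\<close> of natural numbers is an extensional function
  on \<open>A\<close>, so \<open>space (vec_space A)\<close> is \<open>A \<rightarrow>\<^sub>E UNIV\<close>: this is \<open>\<real>\<^sup>n\<close> for \<open>A = {1..n}\<close>, \<open>\<real>\<^sup>i\<close> for \<open>A = I\<close>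
  and \<open>\<real>\<^sup>n\<^sup>-\<^sup>i\<close> for \<open>A = {1..n} - I\<close>. Coordinates keep their original indices, so no re-enumeration is needed.
\<close>
abbreviation vec_space :: "nat set \<Rightarrow> (nat \<Rightarrow> real) measure" where
  "vec_space A \<equiv> Pi\<^sub>M A (\<lambda>_. borel)"

definition subvec :: "(nat \<Rightarrow> 'a \<Rightarrow> real) \<Rightarrow> nat set \<Rightarrow> 'a \<Rightarrow> nat \<Rightarrow> real" where
  "subvec X A \<omega> = (\<lambda>j\<in>A. X j \<omega>)"

definition continuous_rv :: "'a measure \<Rightarrow> ('a \<Rightarrow> 'b::euclidean_space) \<Rightarrow> bool" where
  "continuous_rv M Y \<longleftrightarrow> (\<exists>g. distributed M lborel Y g)"

definition sigma_I :: "nat \<Rightarrow> nat set \<Rightarrow> (nat \<Rightarrow> real) \<Rightarrow> (nat \<Rightarrow> real) \<Rightarrow> nat \<Rightarrow> real" where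
  "sigma_I n I x y = merge ({1..n} - I) I (x, y)"

definition event_E :: "nat \<Rightarrow> ((nat \<Rightarrow> real) \<Rightarrow> 'b) \<Rightarrow> 'b \<Rightarrow> (nat \<Rightarrow> real) set" where
  "event_E n T t = {z \<in> space (vec_space {1..n}). T z = t}"

definition completable ::
  "nat \<Rightarrow> ((nat \<Rightarrow> real) \<Rightarrow> 'b) \<Rightarrow> nat set \<Rightarrow> 'b \<Rightarrow> (nat \<Rightarrow> real) set" where
  "completable n T I t =
     {x \<in> space (vec_space ({1..n} - I)). \<exists>y\<in>space (vec_space I). sigma_I n I x y \<in> event_E n T t}"

definition DSH :: "nat \<Rightarrow> ((nat \<Rightarrow> real) \<Rightarrow> 'b) \<Rightarrow> nat set \<Rightarrow> 'b \<Rightarrow> bool" where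
  "DSH n T I t \<longleftrightarrow>
     (\<forall>x\<in>completable n T I t. \<exists>!y. y \<in> space (vec_space I) \<and> sigma_I n I x y \<in> event_E n T t)"

definition y_I ::
  "nat \<Rightarrow> ((nat \<Rightarrow> real) \<Rightarrow> 'b) \<Rightarrow> nat set \<Rightarrow> 'b \<Rightarrow> (nat \<Rightarrow> real) \<Rightarrow> nat \<Rightarrow> real" where
  "y_I n T I t x = (THE y. y \<in> space (vec_space I) \<and> sigma_I n I x y \<in> event_E n T t)"

definition t_I ::
  "nat \<Rightarrow> ((nat \<Rightarrow> real) \<Rightarrow> 'b) \<Rightarrow> nat set \<Rightarrow> 'b \<Rightarrow> (nat \<Rightarrow> real) \<Rightarrow> 'b" where
  "t_I n T I t x = T (sigma_I n I x (y_I n T I t x))"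

text \<open>\<open>f x\<close> is a density of \<open>T\<close> evaluated at \<open>x\<close> completed by the random second half \<open>X\<^sub>I\<close>.\<close>
definition conditional_density ::
  "'a measure \<Rightarrow> nat \<Rightarrow> (nat \<Rightarrow> 'a \<Rightarrow> real) \<Rightarrow> ((nat \<Rightarrow> real) \<Rightarrow> 'b::euclidean_space) \<Rightarrow> nat set
    \<Rightarrow> ((nat \<Rightarrow> real) \<Rightarrow> 'b \<Rightarrow> real) \<Rightarrow> bool" where
  "conditional_density M n X T I f \<longleftrightarrow>
     (\<lambda>(x, s). f x s) \<in> borel_measurable (vec_space ({1..n} - I) \<Otimes>\<^sub>M borel) \<and>
     (\<forall>x\<in>space (vec_space ({1..n} - I)).
        (\<forall>s. 0 \<le> f x s) \<and>
        distributed M lborel (\<lambda>\<omega>. T (sigma_I n I x (subvec X I \<omega>))) (\<lambda>s. ennreal (f x s)))"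

definition q_fun ::
  "nat \<Rightarrow> ((nat \<Rightarrow> real) \<Rightarrow> 'b) \<Rightarrow> nat set \<Rightarrow> ((nat \<Rightarrow> real) \<Rightarrow> 'b \<Rightarrow> real) \<Rightarrow> 'b
    \<Rightarrow> (nat \<Rightarrow> real) \<Rightarrow> real" where
  "q_fun n T I f t x = (if x \<in> completable n T I t then f x (t_I n T I t x) else 0)"

definition A1 ::
  "nat \<Rightarrow> ((nat \<Rightarrow> real) \<Rightarrow> 'b) \<Rightarrow> nat set \<Rightarrow> ((nat \<Rightarrow> real) \<Rightarrow> 'b \<Rightarrow> real) \<Rightarrow> 'b \<Rightarrow> bool" where
  "A1 n T I f t \<longleftrightarrow>
     bdd_above (q_fun n T I f t ` space (vec_space ({1..n} - I))) \<and>
     0 < (SUP x\<in>space (vec_space ({1..n} - I)). q_fun n T I f t x)"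

text \<open>
  Under \<open>DSH\<close> the event below is measurable: \<open>completable n T I t\<close> is then an injective projection of
  a Borel set, hence Borel (Lusin--Souslin).
\<close>
definition A2 ::
  "'a measure \<Rightarrow> nat \<Rightarrow> (nat \<Rightarrow> 'a \<Rightarrow> real) \<Rightarrow> ((nat \<Rightarrow> real) \<Rightarrow> 'b) \<Rightarrow> nat set
    \<Rightarrow> ((nat \<Rightarrow> real) \<Rightarrow> 'b \<Rightarrow> real) \<Rightarrow> 'b \<Rightarrow> bool" where
  "A2 M n X T I f t \<longleftrightarrow>
     0 < measure M {\<omega> \<in> space M. q_fun n T I f t (subvec X ({1..n} - I) \<omega>) > 0}"

definition disintegration ::
  "'c measure \<Rightarrow> ('c \<Rightarrow> 'b::topological_space) \<Rightarrow> ('b \<Rightarrow> 'c measure) \<Rightarrow> bool" where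
  "disintegration \<mu> T P \<longleftrightarrow>
     (\<forall>t. prob_space (P t) \<and> sets (P t) = sets \<mu>) \<and>
     (AE t in distr \<mu> borel T. emeasure (P t) {z \<in> space \<mu>. T z \<noteq> t} = 0) \<and>
     (\<forall>h::'c \<Rightarrow> ennreal. h \<in> borel_measurable \<mu> \<longrightarrow>
        (\<lambda>t. \<integral>\<^sup>+z. h z \<partial>P t) \<in> borel_measurable borel \<and>
        (\<integral>\<^sup>+z. h z \<partial>\<mu>) = (\<integral>\<^sup>+t. (\<integral>\<^sup>+z. h z \<partial>P t) \<partial>distr \<mu> borel T))"

text \<open>
  The randomness consumed by the rejection loop: round \<open>k\<close> draws \<open>V k\<close> from the law of \<open>X\<^sup>(\<^sup>I\<^sup>)\<close> and,
  independently, \<open>U k\<close> uniformly from \<open>(0,1)\<close>; the rounds are independent.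
\<close>
definition fresh_draws ::
  "'a measure \<Rightarrow> nat \<Rightarrow> (nat \<Rightarrow> 'a \<Rightarrow> real) \<Rightarrow> nat set \<Rightarrow> 'd measure
    \<Rightarrow> (nat \<Rightarrow> 'd \<Rightarrow> nat \<Rightarrow> real) \<Rightarrow> (nat \<Rightarrow> 'd \<Rightarrow> real) \<Rightarrow> bool" where
  "fresh_draws M n X I \<Omega> V U \<longleftrightarrow>
     prob_space \<Omega> \<and>
     prob_space.indep_vars \<Omega> (\<lambda>_. vec_space ({1..n} - I) \<Otimes>\<^sub>M borel) (\<lambda>k \<omega>. (V k \<omega>, U k \<omega>)) UNIV \<and>
     (\<forall>k. distr \<Omega> (vec_space ({1..n} - I) \<Otimes>\<^sub>M borel) (\<lambda>\<omega>. (V k \<omega>, U k \<omega>)) =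
        distr M (vec_space ({1..n} - I)) (subvec X ({1..n} - I)) \<Otimes>\<^sub>M uniform_measure lborel {0<..<1})"

definition accepts ::
  "nat \<Rightarrow> ((nat \<Rightarrow> real) \<Rightarrow> 'b) \<Rightarrow> nat set \<Rightarrow> ((nat \<Rightarrow> real) \<Rightarrow> 'b \<Rightarrow> real) \<Rightarrow> 'b
    \<Rightarrow> (nat \<Rightarrow> real) \<Rightarrow> real \<Rightarrow> bool" where
  "accepts n T I f t x u \<longleftrightarrow>
     x \<in> completable n T I t \<and>
     u < f x (t_I n T I t x) / (SUP l\<in>completable n T I t. f l (t_I n T I t l))"

text \<open>The value returned by the algorithm (probabilistic divide-and-conquer) in the first accepting
  round; it is only meaningful if there is one.\<close>
definition pdc_output ::
  "nat \<Rightarrow> ((nat \<Rightarrow> real) \<Rightarrow> 'b) \<Rightarrow> nat set \<Rightarrow> ((nat \<Rightarrow> real) \<Rightarrow> 'b \<Rightarrow> real) \<Rightarrow> 'b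
    \<Rightarrow> (nat \<Rightarrow> 'd \<Rightarrow> nat \<Rightarrow> real) \<Rightarrow> (nat \<Rightarrow> 'd \<Rightarrow> real) \<Rightarrow> 'd \<Rightarrow> nat \<Rightarrow> real" where
  "pdc_output n T I f t V U \<omega> =
     (let k = (LEAST k. accepts n T I f t (V k \<omega>) (U k \<omega>))
      in sigma_I n I (V k \<omega>) (y_I n T I t (V k \<omega>)))"

text \<open>
  Exact sampling: almost surely some round accepts, and the output has law \<open>Q\<close>. The output is a
  random variable on the completed probability space, as it is arbitrary on the null event of
  non-termination, which makes it only almost surely equal to a measurable function.
\<close>
definition pdc_samples_from ::
  "nat \<Rightarrow> ((nat \<Rightarrow> real) \<Rightarrow> 'b) \<Rightarrow> nat set \<Rightarrow> ((nat \<Rightarrow> real) \<Rightarrow> 'b \<Rightarrow> real) \<Rightarrow> 'b \<Rightarrow> 'd measure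
    \<Rightarrow> (nat \<Rightarrow> 'd \<Rightarrow> nat \<Rightarrow> real) \<Rightarrow> (nat \<Rightarrow> 'd \<Rightarrow> real) \<Rightarrow> (nat \<Rightarrow> real) measure \<Rightarrow> bool" where
  "pdc_samples_from n T I f t \<Omega> V U Q \<longleftrightarrow>
     (AE \<omega> in \<Omega>. \<exists>k. accepts n T I f t (V k \<omega>) (U k \<omega>)) \<and>
     pdc_output n T I f t V U \<in> completion \<Omega> \<rightarrow>\<^sub>M vec_space {1..n} \<and>
     distr (completion \<Omega>) (vec_space {1..n}) (pdc_output n T I f t V U) = Q"

end

theory Submission imports Defs begin

text \<open>
  Let \<open>\<nu>\<close> be the law of \<open>X\<^sup>(\<^sup>I\<^sup>)\<close>. By independence the pair \<open>(X\<^sup>(\<^sup>I\<^sup>), T)\<close> has density \<open>f x s\<close> with respect to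
  \<open>\<nu> \<Otimes> lborel\<close>, so for almost every \<open>t\<close> the first half of a vector drawn from \<open>P t\<close> has \<open>\<nu>\<close>-density
  \<open>f x t / g t\<close>, where \<open>g\<close> is the density of \<open>T\<close>. On the fibre \<open>E = {T = t}\<close> the first half determines
  the vector, and rejection sampling with acceptance probability proportional to \<open>f x t\<close> on \<open>E\<^sup>(\<^sup>I\<^sup>)\<close>
  produces the law of the first half.

  Measurability of \<open>E\<^sup>(\<^sup>I\<^sup>)\<close> and of \<open>y\<^sub>I\<close> is only needed almost surely, which avoids the Lusin--Souslin
  theorem: by inner regularity \<open>P t\<close> is carried by countably many compact subsets of \<open>E\<close>. Their
  projections are compact subsets of \<open>E\<^sup>(\<^sup>I\<^sup>)\<close>, outside of which \<open>f x t = 0\<close> for \<open>\<nu>\<close>-almost every \<open>x\<close>.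
\<close>

section \<open>Rejection sampling\<close>

text \<open>A preimage under \<open>h\<close> differs from one under \<open>g\<close> by a subset of
  a null set, and completion makes all such subsets measurable. This carries the law of a measurable
  version of the algorithm's output over to \<open>pdc_output\<close>, whose own measurability is
  not established.\<close>

lemma completion_AE_eq:
  assumes g: "g \<in> M \<rightarrow>\<^sub>M N" and eq: "AE x in M. h x = g x" and h: "h \<in> space M \<rightarrow> space N"
  shows measurable_completion_AE_eq: "h \<in> completion M \<rightarrow>\<^sub>M N"
    and distr_completion_AE_eq: "distr (completion M) N h = distr M N g"
proof -
  have eq': "AE x in completion M. h x = g x"
    using eq by (rule AE_completion)
  show meas: "h \<in> completion M \<rightarrow>\<^sub>M N"
  proof (rule measurableI)
    fix B assume B: "B \<in> sets N"
    have "g -` B \<inter> space (completion M) \<in> sets (completion M)"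
      using measurable_sets[OF measurable_completion[OF g] B] .
    moreover have "AE x in completion M. x \<in> g -` B \<inter> space (completion M) \<longleftrightarrow> x \<in> h -` B \<inter> space (completion M)"
      using eq' by eventually_elim auto
    ultimately show "h -` B \<inter> space (completion M) \<in> sets (completion M)"
      using completion.in_sets_AE by blast
  qed (use h in auto)
  have "distr (completion M) N h = distr (completion M) N g"
    using meas measurable_completion[OF g] eq' by (intro distr_cong_AE) auto
  then show "distr (completion M) N h = distr M N g"
    using g by (simp add: distr_completion)
qed

text \<open>The first hit of \<open>A\<close> occurs in round \<open>k\<close> with value in
  \<open>B\<close> with probability \<open>(1 - measure D A) ^ k * measure D (A \<inter> B)\<close>.
  These events are disjoint in \<open>k\<close>, and the geometric series sums to the conditional
  probability of \<open>B\<close> given \<open>A\<close>.\<close>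

lemma (in prob_space) rejection_sampling:
  assumes indep: "indep_vars (\<lambda>_. N) Z (UNIV :: nat set)"
    and law: "\<And>k. distr M N (Z k) = D"
    and A: "A \<in> sets N" and pos: "0 < measure D A"
  shows rejection_sampling_terminates: "AE \<omega> in M. \<exists>k. Z k \<omega> \<in> A"
    and rejection_sampling_law: "\<And>B. B \<in> sets N \<Longrightarrow>
      prob {\<omega>\<in>space M. Z (LEAST k. Z k \<omega> \<in> A) \<omega> \<in> B} = measure D (A \<inter> B) / measure D A"
proof -
  have Z[measurable]: "random_variable N (Z k)" for k
    using indep by (auto simp: indep_vars_def)
  note A[measurable]
  have prob_Z: "prob (Z k -` C \<inter> space M) = measure D C" if "C \<in> sets N" for k C
    using that by (simp add: law[of k, symmetric] measure_distr)
  interpret D: prob_space D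
    using prob_space_distr[OF Z[of 0]] by (simp add: law)
  have sets_D: "sets D = sets N" by (simp add: law[of 0, symmetric])
  have space_D: "space D = space N" by (simp add: law[of 0, symmetric])
  define F where "F B k = {\<omega>\<in>space M. (\<forall>j<k. Z j \<omega> \<notin> A) \<and> Z k \<omega> \<in> A \<inter> B}" for B k
  have F_sets[measurable]: "F B k \<in> events" if [measurable]: "B \<in> sets N" for B k
    unfolding F_def by measurable
  have prob_F: "prob (F B k) = (1 - measure D A) ^ k * measure D (A \<inter> B)" if B: "B \<in> sets N" for B k
  proof -
    \<comment> \<open>One target set per round turns \<open>F B k\<close> into a finite intersection
      of events about separate rounds, to which independence applies.\<close>
    define C where "C i = (if i < k then space N - A else A \<inter> B)" for i
    have "prob (F B k) = prob (\<Inter>i\<in>{..k}. Z i -` C i \<inter> space M)"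
    proof (rule arg_cong[where f = prob])
      show "F B k = (\<Inter>i\<in>{..k}. Z i -` C i \<inter> space M)"
      proof (intro set_eqI iffI)
        fix w assume "w \<in> F B k"
        then show "w \<in> (\<Inter>i\<in>{..k}. Z i -` C i \<inter> space M)"
          using measurable_space[OF Z] by (auto simp: F_def C_def)
      next
        fix w assume w: "w \<in> (\<Inter>i\<in>{..k}. Z i -` C i \<inter> space M)"
        then have *: "Z i w \<in> C i" "w \<in> space M" if "i \<le> k" for i using that by auto
        show "w \<in> F B k"
          using *(1)[of k] *(2)[of k] *(1)[OF less_imp_le] by (auto simp: F_def C_def)
      qed
    qed
    also have "\<dots> = (\<Prod>i\<in>{..k}. prob (Z i -` C i \<inter> space M))"
      using indep_vars_subset[OF indep, of "{..k}"] B
      by (intro indep_varsD_finite) (auto simp: C_def)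
    also have "\<dots> = (\<Prod>i\<in>{..k}. measure D (C i))"
      using B by (intro prod.cong prob_Z refl) (auto simp: C_def)
    also have "\<dots> = (\<Prod>i<k. measure D (C i)) * measure D (C k)"
      by (simp add: lessThan_Suc_atMost[symmetric])
    also have "(\<Prod>i<k. measure D (C i)) = (\<Prod>i<k. 1 - measure D A)"
      using D.prob_compl[of A] by (intro prod.cong) (auto simp: C_def space_D sets_D)
    finally show ?thesis by (simp add: C_def)
  qed
  have disj: "disjoint_family (F B)" for B
    unfolding disjoint_family_on_def
  proof (intro ballI impI)
    fix m n :: nat assume "m \<noteq> n"
    then show "F B m \<inter> F B n = {}"
      by (cases "m < n") (auto simp: F_def)
  qed
  have prob_UN: "prob (\<Union>k. F B k) = measure D (A \<inter> B) / measure D A" if B: "B \<in> sets N" for B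
  proof -
    have "(\<lambda>k. prob (F B k)) sums prob (\<Union>k. F B k)"
      using B disj by (intro finite_measure_UNION) auto
    \<comment> \<open>The ratio \<open>1 - measure D A\<close> lies in \<open>[0, 1)\<close>; its
      being below 1 is exactly the positivity of \<open>measure D A\<close>.\<close>
    moreover have "(\<lambda>k. prob (F B k)) sums (1 / (1 - (1 - measure D A)) * measure D (A \<inter> B))"
      unfolding prob_F[OF B] using pos D.prob_le_1[of A]
      by (intro sums_mult2 geometric_sums, unfold real_norm_def) linarith
    ultimately show ?thesis by (simp add: sums_unique2)
  qed
  \<comment> \<open>With no restriction on the value, the sum of the series is the probability that
    some round hits \<open>A\<close>.\<close>
  have "prob (\<Union>k. F (space N) k) = 1"
    using prob_UN[of "space N"] pos A sets.sets_into_space[OF A] by (simp add: Int_absorb2)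
  moreover have "(\<Union>k. F (space N) k) \<in> events" by auto
  ultimately have "AE \<omega> in M. \<omega> \<in> (\<Union>k. F (space N) k)"
    using prob_eq_1 by blast
  then show ex: "AE \<omega> in M. \<exists>k. Z k \<omega> \<in> A"
    by eventually_elim (auto simp: F_def)
  show "prob {\<omega>\<in>space M. Z (LEAST k. Z k \<omega> \<in> A) \<omega> \<in> B} = measure D (A \<inter> B) / measure D A"
    if B[measurable]: "B \<in> sets N" for B
  proof -
    have "prob {\<omega>\<in>space M. Z (LEAST k. Z k \<omega> \<in> A) \<omega> \<in> B} = prob (\<Union>k. F B k)"
    proof (rule measure_eq_AE)
      \<comment> \<open>The events agree only almost surely: when no round hits \<open>A\<close>,
        the \<open>LEAST\<close> index is unspecified.\<close>
      show "AE \<omega> in M. \<omega> \<in> {\<omega> \<in> space M. Z (LEAST k. Z k \<omega> \<in> A) \<omega> \<in> B} \<longleftrightarrow> \<omega> \<in> (\<Union>k. F B k)"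
        using ex AE_space
      proof eventually_elim
        case (elim w)
        then obtain k where k: "Z k w \<in> A" by blast
        let ?L = "LEAST k. Z k w \<in> A"
        have L: "Z ?L w \<in> A" using k by (rule LeastI)
        have nL: "Z j w \<notin> A" if "j < ?L" for j using that by (rule not_less_Least)
        have F_eq: "m = ?L" if m: "w \<in> F B m" for m
        proof (rule antisym)
          show "m \<le> ?L"
          proof (rule ccontr)
            assume "\<not> m \<le> ?L"
            then have "?L < m" by simp
            with m have "Z ?L w \<notin> A" unfolding F_def by blast
            with L show False by contradiction
          qed
          show "?L \<le> m" using m unfolding F_def by (intro Least_le) blast
        qed
        show ?case
        proof
          assume "w \<in> {\<omega> \<in> space M. Z (LEAST k. Z k \<omega> \<in> A) \<omega> \<in> B}"
          then have "w \<in> F B ?L"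
            using L nL elim(2) unfolding F_def by blast
          then show "w \<in> (\<Union>k. F B k)" by blast
        next
          assume "w \<in> (\<Union>k. F B k)"
          then obtain m where m: "w \<in> F B m" by blast
          then have "Z m w \<in> B" unfolding F_def by blast
          then show "w \<in> {\<omega> \<in> space M. Z (LEAST k. Z k \<omega> \<in> A) \<omega> \<in> B}"
            using F_eq[OF m] elim(2) by simp
        qed
      qed
    qed measurable
    with prob_UN[OF B] show ?thesis by simp
  qed
qed

section \<open>The Borel structure of vectors with coordinates in a set of indices\<close>

text \<open>The identity is measurable in both directions because both \<sigma>-algebras are
  governed by coordinates, of which there are countably many. Vectors thereby become points of the
  Polish space \<open>nat \<Rightarrow> real\<close>, where inner regularity holds.\<close>

lemma sets_vec_space:
  "sets (vec_space A) = sets (restrict_space (borel :: (nat \<Rightarrow> real) measure) (space (vec_space A)))"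
proof -
  have idm: "(\<lambda>x. x) \<in> vec_space A \<rightarrow>\<^sub>M borel"
  proof -
    have "(\<lambda>x. x) \<in> vec_space A \<rightarrow>\<^sub>M Pi\<^sub>M UNIV (\<lambda>_. borel)"
    proof (rule measurable_PiM_single')
      fix i :: nat
      show "(\<lambda>x. x i) \<in> vec_space A \<rightarrow>\<^sub>M borel"
      proof (cases "i \<in> A")
        case False
        \<comment> \<open>Outside \<open>A\<close> every extensional function takes the default
          value, so this coordinate is constant.\<close>
        have "(\<lambda>x. undefined) \<in> vec_space A \<rightarrow>\<^sub>M borel" by simp
        then show ?thesis
          by (rule measurable_cong[THEN iffD1, rotated])
            (use False in \<open>auto simp: space_PiM PiE_def extensional_def\<close>)
      qed simp
    qed auto
    then show ?thesis
      using measurable_cong_sets[OF refl sets_PiM_equal_borel] by blast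
  qed
  have idr: "(\<lambda>x. x) \<in> restrict_space borel (space (vec_space A)) \<rightarrow>\<^sub>M vec_space A"
  proof (rule measurable_PiM_single')
    fix i assume "i \<in> A"
    have "(\<lambda>x. x i) \<in> borel \<rightarrow>\<^sub>M (borel :: real measure)"
      by (intro borel_measurable_continuous_onI continuous_on_product_coordinates)
    then show "(\<lambda>x. x i) \<in> restrict_space borel (space (vec_space A)) \<rightarrow>\<^sub>M borel"
      by (rule measurable_restrict_space1)
  qed (auto simp: space_restrict_space space_PiM)
  show ?thesis
  proof (intro equalityI subsetI)
    fix S assume S: "S \<in> sets (vec_space A)"
    have "(\<lambda>x. x) -` S \<inter> space (restrict_space borel (space (vec_space A)))
        \<in> sets (restrict_space borel (space (vec_space A)))"
      by (rule measurable_sets[OF idr S])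
    then show "S \<in> sets (restrict_space borel (space (vec_space A)))"
      using sets.sets_into_space[OF S] by (simp add: space_restrict_space Int_absorb2)
  next
    fix S assume "S \<in> sets (restrict_space (borel :: (nat \<Rightarrow> real) measure) (space (vec_space A)))"
    then obtain C where "C \<in> sets borel" "S = space (vec_space A) \<inter> C"
      by (auto simp: sets_restrict_space)
    then show "S \<in> sets (vec_space A)"
      using measurable_sets[OF idm, of C] by (simp add: Int_commute)
  qed
qed

text \<open>Being extensional fixes each coordinate outside \<open>A\<close>, and each of these
  conditions is closed in the product topology.\<close>

lemma space_vec_space_borel: "space (vec_space A) \<in> sets (borel :: (nat \<Rightarrow> real) measure)"
proof -
  have "space (vec_space A) = (\<Inter>i\<in>-A. (\<lambda>x. x i) -` {undefined})"
    by (auto simp: space_PiM PiE_def extensional_def)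
  moreover have "closed (\<Inter>i\<in>-A. (\<lambda>x :: nat \<Rightarrow> real. x i) -` {undefined})"
    by (intro closed_INT ballI closed_vimage continuous_on_product_coordinates closed_singleton)
  ultimately show ?thesis by auto
qed

lemma sets_vec_space_borel: "S \<in> sets (vec_space A) \<longleftrightarrow> S \<in> sets (borel :: (nat \<Rightarrow> real) measure) \<and> S \<subseteq> space (vec_space A)"
  by (auto simp: sets_vec_space sets_restrict_space_iff space_vec_space_borel)

text \<open>Finite intersections of a countable basis form such a family, the empty intersection
  giving \<open>UNIV\<close>. Countability allows the exceptional null sets of the single generators
  to be merged, and intersection stability gives uniqueness of measures.\<close>

lemma borel_countable_Int_stable_generator:
  obtains G :: "'a::second_countable_topology set set"
  where "countable G" "Int_stable G" "sets borel = sigma_sets UNIV G" "UNIV \<in> G"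
proof -
  obtain B :: "'a set set" where B: "countable B" "topological_basis B"
    using ex_countable_basis by blast
  define G where "G = Inter ` {F. finite F \<and> F \<subseteq> B}"
  have "countable G"
    unfolding G_def using B(1) by (intro countable_image countable_Collect_finite_subset)
  moreover have "Int_stable G"
  proof (rule Int_stableI)
    fix a b assume "a \<in> G" "b \<in> G"
    then obtain F F' where "finite F" "F \<subseteq> B" "a = \<Inter>F" "finite F'" "F' \<subseteq> B" "b = \<Inter>F'"
      by (auto simp: G_def)
    then show "a \<inter> b \<in> G"
      unfolding G_def by (intro image_eqI[of _ _ "F \<union> F'"]) auto
  qed
  moreover have "sets borel = sigma_sets UNIV G"
  proof
    have "sets borel = sigma_sets UNIV B"
      unfolding borel_eq_countable_basis[OF B] by simp
    moreover have "B \<subseteq> G"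
      unfolding G_def by (auto intro!: image_eqI[of _ _ "{_}"])
    ultimately show "sets borel \<subseteq> sigma_sets UNIV G"
      by (simp add: sigma_sets_mono')
    have "G \<subseteq> sets borel"
      using B topological_basis_open[OF B(2)] by (auto simp: G_def intro!: borel_open open_Inter)
    then show "sigma_sets UNIV G \<subseteq> sets borel"
      using sets.sigma_sets_subset[of G borel] by simp
  qed
  moreover have "UNIV \<in> G"
    unfolding G_def by (intro image_eqI[of _ _ "{}"]) auto
  ultimately show ?thesis by (rule that)
qed

text \<open>The traces of a generator of the ambient Borel sets on the Borel set
  \<open>space (vec_space A)\<close> inherit all the required properties.\<close>

lemma countable_generator_vec_space:
  obtains G where "countable G" "Int_stable G" "sets (vec_space A) = sigma_sets (space (vec_space A)) G"
    "space (vec_space A) \<in> G" "G \<subseteq> Pow (space (vec_space A))"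
proof -
  obtain G :: "(nat \<Rightarrow> real) set set" where G: "countable G" "Int_stable G" "sets borel = sigma_sets UNIV G" "UNIV \<in> G"
    by (rule borel_countable_Int_stable_generator)
  let ?S = "space (vec_space A)"
  show ?thesis
  proof (rule that)
    show "countable ((\<inter>) ?S ` G)" using G(1) by simp
    show "Int_stable ((\<inter>) ?S ` G)"
    proof (rule Int_stableI)
      fix a b assume "a \<in> (\<inter>) ?S ` G" "b \<in> (\<inter>) ?S ` G"
      then obtain a' b' where "a' \<in> G" "b' \<in> G" "a = ?S \<inter> a'" "b = ?S \<inter> b'" by blast
      then have "a \<inter> b = ?S \<inter> (a' \<inter> b')" "a' \<inter> b' \<in> G"
        using G(2) unfolding Int_stable_def by blast+
      then show "a \<inter> b \<in> (\<inter>) ?S ` G" by (rule image_eqI)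
    qed
    show "sets (vec_space A) = sigma_sets ?S ((\<inter>) ?S ` G)"
      unfolding sets_vec_space sets_restrict_space G(3)
      by (rule sigma_sets_Int) (use space_vec_space_borel[of A] G(3) in auto)
    show "?S \<in> (\<inter>) ?S ` G" using G(4) by blast
  qed blast
qed

section \<open>Measurable inverses up to null sets\<close>

text \<open>Inner regularity supplies compact sets \<open>K m\<close> inside \<open>E\<close> that
  together carry \<open>Q\<close>. On each of them \<open>p\<close> maps closed sets to compact,
  hence closed, sets, so the preimages of closed sets under the inverse are Borel.\<close>

lemma AE_measurable_section:
  fixes Q :: "'a::polish_space measure" and p :: "'a \<Rightarrow> 'b::t2_space"
  assumes Q: "finite_measure Q" "sets Q = sets borel"
    and E: "E \<in> sets borel" "AE z in Q. z \<in> E"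
    and p: "continuous_on E p" "inj_on p E"
  obtains S \<phi> where "S \<in> sets borel" "S \<subseteq> p ` E" "AE z in Q. p z \<in> S"
    "\<phi> \<in> borel_measurable borel" "\<And>z. z \<in> E \<Longrightarrow> p z \<in> S \<Longrightarrow> \<phi> (p z) = z"
proof -
  interpret Q: finite_measure Q by fact
  let ?\<K> = "{K. K \<subseteq> E \<and> compact K}"
  \<comment> \<open>The supremum over all compact subsets is reached along a sequence, so countably
    many of them exhaust \<open>E\<close> up to a null set.\<close>
  have "emeasure Q E = (SUP K\<in>?\<K>. emeasure Q K)"
    using Q E(1) by (intro inner_regular) (auto simp: Q.emeasure_finite)
  moreover have "{} \<in> ?\<K>" by simp
  then have "emeasure Q ` ?\<K> \<noteq> {}" unfolding image_is_empty by (metis empty_iff)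
  then have "\<exists>h::nat \<Rightarrow> ennreal. incseq h \<and> range h \<subseteq> emeasure Q ` ?\<K> \<and> Sup (emeasure Q ` ?\<K>) = (SUP i. h i)"
    by (rule ennreal_Sup_countable_SUP)
  ultimately obtain h :: "nat \<Rightarrow> ennreal"
    where h: "range h \<subseteq> emeasure Q ` ?\<K>" "emeasure Q E = (SUP i. h i)" by auto
  have "\<exists>K. K \<subseteq> E \<and> compact K \<and> h m = emeasure Q K" for m
    using h(1) by (auto simp: image_subset_iff)
  then obtain K where K: "\<And>m. K m \<subseteq> E" "\<And>m. compact (K m)" "\<And>m. h m = emeasure Q (K m)"
    by metis
  have K_sets[measurable]: "K m \<in> sets borel" for m
    using K(2) by (simp add: compact_imp_closed)
  have Q_sets: "S \<in> sets Q" if "S \<in> sets borel" for S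
    using that Q(2) by simp
  let ?U = "\<Union>m. K m"
  have "emeasure Q ?U = emeasure Q E"
  proof (rule antisym)
    show "emeasure Q ?U \<le> emeasure Q E"
      using K(1) E(1) by (intro emeasure_mono Q_sets) auto
    show "emeasure Q E \<le> emeasure Q ?U"
      unfolding h(2) by (auto simp: K(3) intro!: SUP_least emeasure_mono Q_sets)
  qed
  then have "emeasure Q (E - ?U) = 0"
    using K(1) E(1) by (subst emeasure_Diff) (auto intro!: Q_sets simp: diff_eq_0_ennreal Q.emeasure_finite less_top)
  then have "AE z in Q. z \<notin> E - ?U"
    using E(1) by (intro AE_not_in null_setsI Q_sets) auto
  with E(2) have AE_U: "AE z in Q. z \<in> ?U"
    by eventually_elim auto
  have comp: "closed (p ` (K m \<inter> C))" if "closed C" for m C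
  proof (intro compact_imp_closed compact_continuous_image)
    show "continuous_on (K m \<inter> C) p"
      using p(1) by (rule continuous_on_subset) (use K(1) in auto)
    show "compact (K m \<inter> C)" using K(2) that by (rule compact_Int_closed)
  qed
  \<comment> \<open>\<open>p ` E\<close> itself need not be known to be Borel; the \<open>\<sigma>\<close>-compact subset \<open>S\<close> carries the image measure.\<close>
  define S where "S = (\<Union>m. p ` K m)"
  define \<phi> where "\<phi> x = (if x \<in> S then inv_into E p x else undefined)" for x
  have S_sets[measurable]: "S \<in> sets borel"
    unfolding S_def using comp[of UNIV] by auto
  have inv: "\<phi> (p z) = z" if "z \<in> E" "p z \<in> S" for z
    using that p(2) by (simp add: \<phi>_def inv_into_f_f)
  have pre: "\<phi> -` C \<in> sets borel" if C: "closed C" for C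
  proof -
    \<comment> \<open>Off \<open>S\<close> the function has the constant value
      \<open>undefined\<close>, so the complement of \<open>S\<close> belongs to the preimage
      precisely when that value lies in \<open>C\<close>.\<close>
    have "\<phi> -` C = (\<Union>m. p ` (K m \<inter> C)) \<union> (if undefined \<in> C then - S else {})"
    proof (intro set_eqI)
      fix x
      show "x \<in> \<phi> -` C \<longleftrightarrow> x \<in> (\<Union>m. p ` (K m \<inter> C)) \<union> (if undefined \<in> C then - S else {})"
      proof (cases "x \<in> S")
        case True
        then obtain m z where z: "z \<in> K m" "x = p z" by (auto simp: S_def)
        then have zE: "z \<in> E" using K(1) by auto
        \<comment> \<open>Injectivity on all of \<open>E\<close> excludes a second preimage of
          \<open>x\<close>, even in another compact set \<open>K m'\<close>.\<close>
        have "z' = z" if "p z' = p z" "z' \<in> K m'" for z' m'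
          using that zE K(1) p(2) by (auto dest!: inj_onD)
        then show ?thesis using z zE True inv[OF zE] by auto
      next
        case False
        then show ?thesis by (auto simp: \<phi>_def S_def)
      qed
    qed
    then show ?thesis using comp[OF C] S_sets by auto
  qed
  show ?thesis
  proof (rule that)
    show "S \<in> sets borel" by fact
    show "S \<subseteq> p ` E" using K(1) by (auto simp: S_def)
    show "AE z in Q. p z \<in> S" using AE_U by eventually_elim (auto simp: S_def)
    show "\<phi> \<in> borel_measurable borel"
    proof (rule borel_measurableI)
      fix U :: "'a set" assume "open U"
      then have "\<phi> -` (- U) \<in> sets borel" by (intro pre) auto
      then have "- (\<phi> -` (- U)) \<in> sets borel" by auto
      then show "\<phi> -` U \<inter> space borel \<in> sets borel" by (simp add: vimage_Compl)
    qed
    show "\<phi> (p z) = z" if "z \<in> E" "p z \<in> S" for z using inv that .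
  qed
qed

text \<open>Pushing \<open>Q\<close> forward to the Borel sets of
  \<open>nat \<Rightarrow> real\<close> makes the Polish-space result applicable: restriction to
  \<open>A\<close> is continuous, since each of its coordinates is a projection or a
  constant.\<close>

lemma AE_measurable_section_vec_space:
  assumes Q: "finite_measure Q" "sets Q = sets (vec_space J)"
    and E: "E \<in> sets (vec_space J)" "AE z in Q. z \<in> E"
    and A: "A \<subseteq> J" and inj: "inj_on (\<lambda>z. restrict z A) E"
  obtains S \<phi> where "S \<in> sets (vec_space A)" "S \<subseteq> (\<lambda>z. restrict z A) ` E"
    "AE z in Q. restrict z A \<in> S" "\<phi> \<in> vec_space A \<rightarrow>\<^sub>M vec_space J"
    "\<And>z. z \<in> E \<Longrightarrow> restrict z A \<in> S \<Longrightarrow> \<phi> (restrict z A) = z"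
proof -
  have to_borel: "h \<in> vec_space K \<rightarrow>\<^sub>M L" if "h \<in> borel \<rightarrow>\<^sub>M L" for h :: "(nat \<Rightarrow> real) \<Rightarrow> 'x" and K L
    using measurable_restrict_space1[OF that] measurable_cong_sets[OF sets_vec_space refl] by blast
  have idm: "(\<lambda>z. z) \<in> Q \<rightarrow>\<^sub>M borel"
    using to_borel[OF measurable_ident] measurable_cong_sets[OF Q(2) refl] by (auto simp: id_def)
  have E_borel: "E \<in> sets borel" and E_sub: "E \<subseteq> space (vec_space J)"
    using E(1) sets_vec_space_borel by auto
  interpret Q: finite_measure Q by fact
  have "continuous_on E (\<lambda>z i. restrict z A i)"
  proof (rule continuous_on_coordinatewise_then_product)
    fix i show "continuous_on E (\<lambda>z. restrict z A i)"
      by (cases "i \<in> A") (auto intro: continuous_on_subset[OF continuous_on_product_coordinates])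
  qed
  then have cont: "continuous_on E (\<lambda>z. restrict z A)" .
  have AE': "(AE z in distr Q borel (\<lambda>z. z). R z) \<longleftrightarrow> (AE z in Q. R z)" if "{z. R z} \<in> sets borel" for R
    using that idm by (subst AE_distr_iff) auto
  obtain S \<phi> where S: "S \<in> sets borel" "S \<subseteq> (\<lambda>z. restrict z A) ` E"
    and S_AE: "AE z in distr Q borel (\<lambda>z. z). restrict z A \<in> S"
    and \<phi>: "\<phi> \<in> borel_measurable borel" "\<And>z. z \<in> E \<Longrightarrow> restrict z A \<in> S \<Longrightarrow> \<phi> (restrict z A) = z"
    using AE_measurable_section[OF Q.finite_measure_distr[OF idm] _ E_borel _ cont inj]
      AE'[of "\<lambda>z. z \<in> E"] E(2) E_borel by auto
  have S_vec: "S \<in> sets (vec_space A)"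
  proof -
    have "S \<subseteq> space (vec_space A)"
      using S(2) by (auto simp: space_PiM)
    then show ?thesis using S(1) sets_vec_space_borel by auto
  qed
  have S_AE': "AE z in Q. restrict z A \<in> S"
    using AE_distrD[OF idm S_AE] .
  \<comment> \<open>The section may take values that are not extensional on \<open>J\<close>.
    Cutting them off lands in \<open>vec_space J\<close> and leaves points of \<open>E\<close>
    unchanged.\<close>
  have "(\<lambda>x. restrict (\<phi> x) J) \<in> vec_space A \<rightarrow>\<^sub>M vec_space J"
  proof (rule measurable_restrict)
    fix i :: nat
    have "(\<lambda>x. x i) \<in> borel \<rightarrow>\<^sub>M (borel :: real measure)"
      by (intro borel_measurable_continuous_onI continuous_on_product_coordinates)
    from measurable_compose[OF \<phi>(1) this]
    show "(\<lambda>x. \<phi> x i) \<in> vec_space A \<rightarrow>\<^sub>M borel" by (rule to_borel)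
  qed
  moreover have "restrict (\<phi> (restrict z A)) J = z" if "z \<in> E" "restrict z A \<in> S" for z
    using \<phi>(2)[OF that] that(1) E_sub by (auto simp: space_PiM PiE_iff extensional_restrict)
  ultimately show ?thesis
    using that[of S "\<lambda>x. restrict (\<phi> x) J"] S_vec S(2) S_AE' by blast
qed

section \<open>Marginals of a disintegration\<close>

text \<open>The measure of \<open>{p z \<in> C, T z \<in> B}\<close> is computed once through the
  disintegration and once through the joint density. As \<open>B\<close> varies, the two integrands
  in \<open>t\<close> become densities of the same measure and hence agree almost
  everywhere.\<close>

lemma disintegration_marginal:
  fixes T :: "'c \<Rightarrow> 'b::euclidean_space"
  assumes \<mu>: "prob_space \<mu>" and T[measurable]: "T \<in> borel_measurable \<mu>" and P: "disintegration \<mu> T P"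
    and p[measurable]: "p \<in> \<mu> \<rightarrow>\<^sub>M N"
    and G: "countable G" "Int_stable G" "sets N = sigma_sets (space N) G" "space N \<in> G" "G \<subseteq> Pow (space N)"
    and \<nu>: "sigma_finite_measure \<nu>" "sets \<nu> = sets N"
    and f[measurable]: "(\<lambda>(x, s). f x s) \<in> borel_measurable (N \<Otimes>\<^sub>M borel)"
    and joint: "\<And>C B. C \<in> sets N \<Longrightarrow> B \<in> sets borel \<Longrightarrow>
      emeasure \<mu> {z\<in>space \<mu>. p z \<in> C \<and> T z \<in> B} = (\<integral>\<^sup>+x\<in>C. (\<integral>\<^sup>+s\<in>B. f x s \<partial>lborel) \<partial>\<nu>)"
    and g[measurable]: "g \<in> borel_measurable borel" and Tg: "distr \<mu> borel T = density lborel g"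
  shows "AE t in distr \<mu> borel T. density (distr (P t) N p) (\<lambda>_. g t) = density \<nu> (\<lambda>x. f x t)"
    and "AE t in distr \<mu> borel T. 0 < g t \<and> g t < \<infinity>"
proof -
  interpret \<mu>: prob_space \<mu> by fact
  interpret \<nu>: sigma_finite_measure \<nu> by fact
  have f'[measurable]: "(\<lambda>(x, s). f x s) \<in> borel_measurable (\<nu> \<Otimes>\<^sub>M lborel)"
    using f by (simp add: measurable_cong_sets[OF sets_pair_measure_cong[OF \<nu>(2) sets_lborel] refl])
  have P_prob: "prob_space (P t)" and P_sets[measurable_cong]: "sets (P t) = sets \<mu>" for t
    using P by (auto simp: disintegration_def)
  note \<nu>(2)[measurable_cong]
  have P_space: "space (P t) = space \<mu>" for t using P_sets by (rule sets_eq_imp_space_eq)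
  have P_fib: "AE t in distr \<mu> borel T. emeasure (P t) {z \<in> space \<mu>. T z \<noteq> t} = 0"
    using P by (auto simp: disintegration_def)
  have P_int: "(\<lambda>t. \<integral>\<^sup>+z. h z \<partial>P t) \<in> borel_measurable borel"
      "(\<integral>\<^sup>+z. h z \<partial>\<mu>) = (\<integral>\<^sup>+t. (\<integral>\<^sup>+z. h z \<partial>P t) \<partial>distr \<mu> borel T)"
    if "h \<in> borel_measurable \<mu>" for h
    using P that unfolding disintegration_def by blast+
  have P_meas: "(\<lambda>t. emeasure (P t) {z\<in>space \<mu>. p z \<in> C}) \<in> borel_measurable borel"
    if [measurable]: "C \<in> sets N" for C
  proof -
    have "indicator {z\<in>space \<mu>. p z \<in> C} \<in> borel_measurable \<mu>" by measurable
    then have "(\<lambda>t. \<integral>\<^sup>+z. indicator {z\<in>space \<mu>. p z \<in> C} z \<partial>P t) \<in> borel_measurable borel"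
      by (rule P_int(1))
    moreover have "{z\<in>space \<mu>. p z \<in> C} \<in> sets (P t)" for t by measurable
    ultimately show ?thesis by simp
  qed
  \<comment> \<open>The exceptional set depends on \<open>C\<close>; the countable generator makes it uniform below.\<close>
  have pt: "AE t in lborel. emeasure (P t) {z\<in>space \<mu>. p z \<in> C} * g t = (\<integral>\<^sup>+x\<in>C. f x t \<partial>\<nu>)"
    if C[measurable]: "C \<in> sets N" for C
  proof (rule sigma_finite_measure.density_unique[OF sigma_finite_lborel])
    note P_meas[OF C, measurable]
    show m1: "(\<lambda>t. emeasure (P t) {z\<in>space \<mu>. p z \<in> C} * g t) \<in> borel_measurable lborel" by measurable
    have "(\<lambda>t. (\<integral>\<^sup>+x. f x t * indicator C x \<partial>\<nu>)) \<in> borel_measurable lborel"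
      by (rule \<nu>.borel_measurable_nn_integral) measurable
    then show m2: "(\<lambda>t. (\<integral>\<^sup>+x\<in>C. f x t \<partial>\<nu>)) \<in> borel_measurable lborel" .
    \<comment> \<open>Both sides are the measure
      \<open>B \<mapsto> \<mu> {p z \<in> C, T z \<in> B}\<close>.\<close>
    show "density lborel (\<lambda>t. emeasure (P t) {z\<in>space \<mu>. p z \<in> C} * g t) =
        density lborel (\<lambda>t. \<integral>\<^sup>+x\<in>C. f x t \<partial>\<nu>)"
    proof (rule measure_eqI)
      fix B assume "B \<in> sets (density lborel (\<lambda>t. emeasure (P t) {z\<in>space \<mu>. p z \<in> C} * g t))"
      then have B[measurable]: "B \<in> sets borel" by simp
      let ?h = "indicator {z\<in>space \<mu>. p z \<in> C \<and> T z \<in> B} :: 'c \<Rightarrow> ennreal"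
      have "emeasure (density lborel (\<lambda>t. emeasure (P t) {z\<in>space \<mu>. p z \<in> C} * g t)) B
          = (\<integral>\<^sup>+t. emeasure (P t) {z\<in>space \<mu>. p z \<in> C} * g t * indicator B t \<partial>lborel)"
        using m1 by (simp add: emeasure_density)
      also have "\<dots> = (\<integral>\<^sup>+t. g t * (emeasure (P t) {z\<in>space \<mu>. p z \<in> C} * indicator B t) \<partial>lborel)"
        by (simp add: ac_simps)
      also have "\<dots> = (\<integral>\<^sup>+t. emeasure (P t) {z\<in>space \<mu>. p z \<in> C} * indicator B t \<partial>distr \<mu> borel T)"
        unfolding Tg by (rule nn_integral_density[symmetric]) auto
      also have "\<dots> = (\<integral>\<^sup>+t. (\<integral>\<^sup>+z. ?h z \<partial>P t) \<partial>distr \<mu> borel T)"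
      proof (rule nn_integral_cong_AE)
        \<comment> \<open>Concentration of \<open>P t\<close> on the fibre replaces the condition
          \<open>T z \<in> B\<close> by \<open>t \<in> B\<close>, a constant factor under the inner
          integral.\<close>
        show "AE t in distr \<mu> borel T. emeasure (P t) {z\<in>space \<mu>. p z \<in> C} * indicator B t = (\<integral>\<^sup>+z. ?h z \<partial>P t)"
          using P_fib
        proof eventually_elim
          case (elim t)
          have "AE z in P t. z \<notin> {z \<in> space \<mu>. T z \<noteq> t}"
            using elim by (intro AE_not_in null_setsI) auto
          then have "AE z in P t. T z = t"
            using AE_space by eventually_elim (auto simp: P_space)
          then have "AE z in P t. ?h z = indicator B t * indicator {z\<in>space \<mu>. p z \<in> C} z"
            by eventually_elim (auto simp: indicator_def)
          then have "(\<integral>\<^sup>+z. ?h z \<partial>P t) = (\<integral>\<^sup>+z. indicator B t * indicator {z\<in>space \<mu>. p z \<in> C} z \<partial>P t)"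
            by (rule nn_integral_cong_AE)
          also have "\<dots> = indicator B t * emeasure (P t) {z\<in>space \<mu>. p z \<in> C}"
            by (intro nn_integral_cmult_indicator) measurable
          finally show ?case by (simp add: ac_simps)
        qed
      qed
      also have "\<dots> = (\<integral>\<^sup>+z. ?h z \<partial>\<mu>)"
      proof -
        have "?h \<in> borel_measurable \<mu>" by measurable
        then show ?thesis by (rule P_int(2)[symmetric])
      qed
      also have "\<dots> = emeasure \<mu> {z\<in>space \<mu>. p z \<in> C \<and> T z \<in> B}"
        by (rule nn_integral_indicator) measurable
      also have "\<dots> = (\<integral>\<^sup>+x. (\<integral>\<^sup>+s. f x s * indicator C x * indicator B s \<partial>lborel) \<partial>\<nu>)"
        unfolding joint[OF C B]
        by (intro nn_integral_cong) (auto simp: indicator_def)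
      also have "\<dots> = (\<integral>\<^sup>+s. (\<integral>\<^sup>+x. f x s * indicator C x * indicator B s \<partial>\<nu>) \<partial>lborel)"
      proof -
        interpret pair_sigma_finite \<nu> "lborel :: 'b measure" ..
        show ?thesis by (rule Fubini'[symmetric]) measurable
      qed
      also have "\<dots> = (\<integral>\<^sup>+s. (\<integral>\<^sup>+x\<in>C. f x s \<partial>\<nu>) * indicator B s \<partial>lborel)"
        by (intro nn_integral_cong) (auto simp: indicator_def)
      also have "\<dots> = emeasure (density lborel (\<lambda>t. \<integral>\<^sup>+x\<in>C. f x t \<partial>\<nu>)) B"
        using m2 by (simp add: emeasure_density)
      finally show "emeasure (density lborel (\<lambda>t. emeasure (P t) {z\<in>space \<mu>. p z \<in> C} * g t)) B =
        emeasure (density lborel (\<lambda>t. \<integral>\<^sup>+x\<in>C. f x t \<partial>\<nu>)) B" .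
    qed simp
  qed
  \<comment> \<open>The law of \<open>T\<close> has a Lebesgue density, so Lebesgue-null exceptional
    sets are null for it too.\<close>
  have AE_T: "AE t in distr \<mu> borel T. R t" if "AE t in lborel. R t" for R
    unfolding Tg using that by (subst AE_density) auto
  have "(\<integral>\<^sup>+t. g t \<partial>lborel) = 1"
  proof -
    have "emeasure (distr \<mu> borel T) UNIV = 1"
      by (simp add: emeasure_distr \<mu>.emeasure_space_1)
    then show ?thesis unfolding Tg by (simp add: emeasure_density)
  qed
  then have "AE t in lborel. g t \<noteq> \<infinity>"
    by (intro nn_integral_PInf_AE) auto
  then have fin: "AE t in distr \<mu> borel T. g t \<noteq> \<infinity>" by (rule AE_T)
  \<comment> \<open>The zero set of a density is null for the measure that it defines.\<close>
  moreover have "AE t in distr \<mu> borel T. 0 < g t"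
    unfolding Tg by (subst AE_density) auto
  ultimately show "AE t in distr \<mu> borel T. 0 < g t \<and> g t < \<infinity>"
    by eventually_elim (auto simp: less_top)
  have G_sets: "C \<in> sets N" if "C \<in> G" for C
    using that G(3) by auto
  have "AE t in lborel. \<forall>C\<in>G. emeasure (P t) {z\<in>space \<mu>. p z \<in> C} * g t = (\<integral>\<^sup>+x\<in>C. f x t \<partial>\<nu>)"
    using G(1) pt[OF G_sets] by (simp add: AE_ball_countable)
  then have "AE t in distr \<mu> borel T. \<forall>C\<in>G. emeasure (P t) {z\<in>space \<mu>. p z \<in> C} * g t = (\<integral>\<^sup>+x\<in>C. f x t \<partial>\<nu>)"
    by (rule AE_T)
  then show "AE t in distr \<mu> borel T. density (distr (P t) N p) (\<lambda>_. g t) = density \<nu> (\<lambda>x. f x t)"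
    using fin
  proof eventually_elim
    case (elim t)
    interpret Pt: prob_space "P t" by (rule P_prob)
    have [measurable]: "p \<in> P t \<rightarrow>\<^sub>M N" using p by (simp cong: measurable_cong_sets)
    have ft: "(\<lambda>x. f x t) \<in> borel_measurable \<nu>" by measurable
    have em: "emeasure (density (distr (P t) N p) (\<lambda>_. g t)) C = emeasure (P t) {z\<in>space \<mu>. p z \<in> C} * g t"
      if [measurable]: "C \<in> sets N" for C
      by (simp add: emeasure_density_const emeasure_distr vimage_def Int_def P_space conj_commute mult.commute)
    show ?case
    proof (rule measure_eqI_generator_eq[OF G(2), of "space N" _ _ "\<lambda>_. space N"])
      show "emeasure (density (distr (P t) N p) (\<lambda>_. g t)) C = emeasure (density \<nu> (\<lambda>x. f x t)) C"
        if "C \<in> G" for C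
        using that elim(1) em[OF G_sets[OF that]] ft G_sets[OF that] \<nu>(2) by (simp add: emeasure_density)
      \<comment> \<open>Uniqueness on the generator needs finite total mass, which here is
        \<open>g t\<close>.\<close>
      show "emeasure (density (distr (P t) N p) (\<lambda>_. g t)) (space N) \<noteq> \<infinity>"
        using elim(2) Pt.emeasure_finite by (subst em) (auto simp: ennreal_mult_eq_top_iff)
    qed (use G \<nu>(2) in auto)
  qed
qed

section \<open>Probabilistic divide-and-conquer\<close>

lemma emeasure_uniform_unit_less:
  assumes "0 \<le> r" "r \<le> (1::real)"
  shows "emeasure (uniform_measure lborel {0<..<1}) {u. u < r} = ennreal r"
proof -
  have "{0<..<1} \<inter> {u. u < r} = {0<..<r}" using assms by auto
  then show ?thesis using assms by (simp add: divide_ennreal_def)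
qed

section \<open>Splitting vectors into halves, and the deterministic second half on a fibre\<close>

lemma restrict_sigma_I:
  assumes "x \<in> space (vec_space ({1..n} - I))" "y \<in> space (vec_space I)"
  shows "restrict (sigma_I n I x y) ({1..n} - I) = x"
  using assms by (auto simp: sigma_I_def merge_def space_PiM PiE_def extensional_def restrict_def fun_eq_iff)

lemma sigma_I_restrict:
  assumes "I \<subseteq> {1..n}" "z \<in> space (vec_space {1..n})"
  shows "sigma_I n I (restrict z ({1..n} - I)) (restrict z I) = z"
  using assms by (auto simp: sigma_I_def merge_def space_PiM PiE_def extensional_def restrict_def fun_eq_iff)

lemma sigma_I_space: "I \<subseteq> {1..n} \<Longrightarrow> sigma_I n I x y \<in> space (vec_space {1..n})"
  by (auto simp: sigma_I_def merge_def space_PiM PiE_def extensional_def)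

text \<open>Gluing with \<open>sigma_I\<close> and restricting to the two index sets undo each
  other. The set thus becomes a projection of the fibre, the shape in which the measurable section
  applies.\<close>

lemma completable_eq_image:
  assumes "I \<subseteq> {1..n}"
  shows "completable n T I t = (\<lambda>z. restrict z ({1..n} - I)) ` event_E n T t"
proof (intro set_eqI iffI)
  fix x assume "x \<in> completable n T I t"
  then obtain y where "x \<in> space (vec_space ({1..n} - I))" "y \<in> space (vec_space I)" "sigma_I n I x y \<in> event_E n T t"
    by (auto simp: completable_def)
  then show "x \<in> (\<lambda>z. restrict z ({1..n} - I)) ` event_E n T t"
    using restrict_sigma_I by (metis image_eqI)
next
  fix x assume "x \<in> (\<lambda>z. restrict z ({1..n} - I)) ` event_E n T t"
  then obtain z where z: "z \<in> event_E n T t" "x = restrict z ({1..n} - I)" by auto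
  then have "sigma_I n I x (restrict z I) = z"
    using sigma_I_restrict[OF assms] by (auto simp: event_E_def)
  then show "x \<in> completable n T I t"
    using z unfolding completable_def by (auto simp: space_PiM intro!: bexI[of _ "restrict z I"])
qed

text \<open>The second half of \<open>z\<close> is itself a completion of its first half, so
  uniqueness in \<open>DSH\<close> identifies it with \<open>y_I\<close>. Completion is therefore a
  left inverse of the projection on the fibre.\<close>

lemma sigma_I_y_I_restrict:
  assumes I: "I \<subseteq> {1..n}" and dsh: "DSH n T I t" and z: "z \<in> event_E n T t"
  shows "sigma_I n I (restrict z ({1..n} - I)) (y_I n T I t (restrict z ({1..n} - I))) = z"
proof -
  let ?x = "restrict z ({1..n} - I)"
  have 1: "sigma_I n I ?x (restrict z I) = z"
    using z by (intro sigma_I_restrict[OF I]) (auto simp: event_E_def)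
  have "?x \<in> completable n T I t"
    using z unfolding completable_eq_image[OF I] by auto
  then have "\<exists>!y. y \<in> space (vec_space I) \<and> sigma_I n I ?x y \<in> event_E n T t"
    using dsh unfolding DSH_def by blast
  then have "y_I n T I t ?x = restrict z I"
    unfolding y_I_def using z 1 by (intro the1_equality) (auto simp: space_PiM)
  then show "sigma_I n I ?x (y_I n T I t ?x) = z"
    using 1 by simp
qed

lemma inj_on_restrict_event_E:
  assumes "I \<subseteq> {1..n}" "DSH n T I t"
  shows "inj_on (\<lambda>z. restrict z ({1..n} - I)) (event_E n T t)"
  by (rule inj_on_inverseI[where g = "\<lambda>x. sigma_I n I x (y_I n T I t x)"])
    (rule sigma_I_y_I_restrict[OF assms])

lemma t_I_completable:
  assumes "I \<subseteq> {1..n}" "DSH n T I t" "x \<in> completable n T I t"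
  shows "t_I n T I t x = t"
  using assms sigma_I_y_I_restrict[OF assms(1,2)]
  by (auto simp: completable_eq_image t_I_def event_E_def)

text \<open>With \<open>t\<close> fixed, a proposal from \<open>\<nu>\<close> is accepted with
  probability \<open>f x t / s\<close>, where \<open>s\<close> is the supremum in the test. By
  \<open>marginal\<close>, acceptance together with output in \<open>B\<close> has probability
  proportional to \<open>measure Q B\<close>, so conditioning on acceptance leaves exactly
  \<open>Q\<close>.\<close>

lemma pdc_samples_fromI:
  fixes T :: "(nat \<Rightarrow> real) \<Rightarrow> 'b::euclidean_space"
  assumes I: "I \<subseteq> {1..n}" and T[measurable]: "T \<in> borel_measurable (vec_space {1..n})"
    and \<nu>: "prob_space \<nu>" "sets \<nu> = sets (vec_space ({1..n} - I))"
    and Q: "prob_space Q" "sets Q = sets (vec_space {1..n})" "AE z in Q. T z = t"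
    and ft[measurable]: "(\<lambda>x. f x t) \<in> borel_measurable (vec_space ({1..n} - I))"
    and f_nonneg: "\<And>x. x \<in> space (vec_space ({1..n} - I)) \<Longrightarrow> 0 \<le> f x t"
    and c: "0 < c" "c < \<infinity>"
    and marginal: "density (distr Q (vec_space ({1..n} - I)) (\<lambda>z. restrict z ({1..n} - I))) (\<lambda>_. c) =
      density \<nu> (\<lambda>x. ennreal (f x t))"
    and dsh: "DSH n T I t" and a1: "A1 n T I f t"
    and \<Omega>: "prob_space \<Omega>"
    and indep: "prob_space.indep_vars \<Omega> (\<lambda>_. vec_space ({1..n} - I) \<Otimes>\<^sub>M borel) (\<lambda>k \<omega>. (V k \<omega>, U k \<omega>)) UNIV"
    and law: "\<And>k. distr \<Omega> (vec_space ({1..n} - I) \<Otimes>\<^sub>M borel) (\<lambda>\<omega>. (V k \<omega>, U k \<omega>)) =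
      \<nu> \<Otimes>\<^sub>M uniform_measure lborel {0<..<1}"
  shows "pdc_samples_from n T I f t \<Omega> V U Q"
proof -
  define A where "A = {1..n} - I"
  note A = A_def[symmetric]
  note [measurable] = ft[unfolded A]
  note f_nonneg = f_nonneg[unfolded A]
  define \<pi> where "\<pi> z = restrict z A" for z :: "nat \<Rightarrow> real"
  define E where "E = event_E n T t"
  define C where "C = completable n T I t"
  define Uni :: "real measure" where "Uni = uniform_measure lborel {0<..<1}"
  define Z where "Z k \<omega> = (V k \<omega>, U k \<omega>)" for k \<omega>
  interpret \<nu>: prob_space \<nu> by fact
  interpret Q: prob_space Q by fact
  interpret \<Omega>: prob_space \<Omega> by fact
  interpret Uni: prob_space Uni
    unfolding Uni_def by (rule prob_space_uniform_measure) auto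
  interpret D: pair_prob_space \<nu> Uni ..
  have [measurable_cong]: "sets \<nu> = sets (vec_space A)" "sets Uni = sets borel" "sets Q = sets (vec_space {1..n})"
    using \<nu>(2) Q(2) by (simp_all add: A_def Uni_def)
  have sp: "space \<nu> = space (vec_space A)" "space Q = space (vec_space {1..n})"
    using \<nu>(2) Q(2) unfolding A by (auto dest: sets_eq_imp_space_eq simp del: One_nat_def)
  have E_space: "z \<in> space (vec_space {1..n})" if "z \<in> E" for z
    using that by (auto simp: E_def event_E_def)
  have E_sets: "E \<in> sets (vec_space {1..n})"
    unfolding E_def event_E_def by measurable
  have E_AE: "AE z in Q. z \<in> E"
    using Q(3) AE_space by eventually_elim (auto simp: E_def event_E_def sp)
  have [measurable]: "\<pi> \<in> vec_space {1..n} \<rightarrow>\<^sub>M vec_space A"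
    unfolding \<pi>_def A_def by (rule measurable_restrict_subset) auto
  have C_image: "C = \<pi> ` E"
    using completable_eq_image[OF I] by (simp add: C_def E_def \<pi>_def A_def)
  have C_space: "C \<subseteq> space (vec_space A)"
    by (auto simp: C_image \<pi>_def space_PiM)
  \<comment> \<open>\<open>S\<close> is a measurable part of the completable set that carries the
    first half under \<open>Q\<close>; on it \<open>\<phi>\<close> is a measurable stand-in for
    completion by \<open>y_I\<close>.\<close>
  obtain S \<phi> where S[measurable]: "S \<in> sets (vec_space A)" and S_sub: "S \<subseteq> \<pi> ` E"
    and S_AE: "AE z in Q. \<pi> z \<in> S" and \<phi>[measurable]: "\<phi> \<in> vec_space A \<rightarrow>\<^sub>M vec_space {1..n}"
    and \<phi>_inv: "\<And>z. z \<in> E \<Longrightarrow> \<pi> z \<in> S \<Longrightarrow> \<phi> (\<pi> z) = z"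
    using AE_measurable_section_vec_space[OF Q.finite_measure_axioms Q(2) E_sets E_AE _
        inj_on_restrict_event_E[OF I dsh, folded E_def]]
    unfolding \<pi>_def A by (metis A_def Diff_subset)
  have sigma_\<phi>: "sigma_I n I x (y_I n T I t x) = \<phi> x" if "x \<in> S" for x
  proof -
    obtain z where z: "z \<in> E" "x = \<pi> z" using \<open>x \<in> S\<close> S_sub by blast
    then show ?thesis
      using sigma_I_y_I_restrict[OF I dsh, of z] \<phi>_inv[of z] that by (simp add: E_def \<pi>_def A_def)
  qed

  define s where "s = (SUP l\<in>C. f l (t_I n T I t l))"
  have s_eq: "s = (SUP l\<in>C. f l t)"
    unfolding s_def C_def by (intro SUP_cong refl) (simp add: t_I_completable[OF I dsh])
  have q_C: "q_fun n T I f t x = f x t" if "x \<in> C" for x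
    using that t_I_completable[OF I dsh] by (simp add: q_fun_def C_def)
  have bdd: "bdd_above ((\<lambda>l. f l t) ` C)"
  proof -
    \<comment> \<open>\<open>A1\<close> concerns \<open>q_fun\<close> on the whole space, whereas
      the test divides by a supremum over \<open>C\<close>; on \<open>C\<close> the two functions
      coincide.\<close>
    have "(\<lambda>l. f l t) ` C \<subseteq> q_fun n T I f t ` space (vec_space A)"
      using q_C C_space by (auto intro!: image_eqI)
    then show ?thesis
      using a1 unfolding A1_def A by (auto intro: bdd_above_mono)
  qed
  have f_le: "f x t \<le> s" if "x \<in> C" for x
    unfolding s_eq using that bdd by (rule cSUP_upper)
  have s_pos: "0 < s"
  proof -
    have "space (vec_space A) \<noteq> {}" by (simp add: space_PiM PiE_eq_empty_iff)
    \<comment> \<open>A positive supremum forces a positive value of \<open>q_fun\<close>, which can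
      only occur inside \<open>C\<close>.\<close>
    then obtain x where "0 < q_fun n T I f t x"
      using a1 unfolding A1_def A by (auto simp: less_cSUP_iff)
    then have "x \<in> C" "0 < f x t"
      using q_C by (auto simp: q_fun_def C_def split: if_splits)
    then show ?thesis using f_le[of x] by linarith
  qed
  have accepts_iff: "accepts n T I f t x u \<longleftrightarrow> x \<in> C \<and> u < f x t / s" for x u
    using t_I_completable[OF I dsh] by (auto simp: accepts_def s_def C_def)

  \<comment> \<open>This is the acceptance region with \<open>C\<close> replaced by
    \<open>S\<close>, which makes it measurable.\<close>
  define Acc where "Acc = {w \<in> space (vec_space A \<Otimes>\<^sub>M borel). fst w \<in> S \<and> snd w < f (fst w) t / s}"
  have Acc_sets[measurable]: "Acc \<in> sets (vec_space A \<Otimes>\<^sub>M borel)"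
    unfolding Acc_def by measurable
  obtain r where r: "c = ennreal r" "0 < r"
    using c by (cases c) auto
  have marg: "(\<integral>\<^sup>+x. ennreal (f x t) * indicator H x \<partial>\<nu>) = c * emeasure Q {z\<in>space Q. \<pi> z \<in> H}"
    if [measurable]: "H \<in> sets (vec_space A)" for H
  proof -
    have "(\<integral>\<^sup>+x. ennreal (f x t) * indicator H x \<partial>\<nu>) = emeasure (density \<nu> (\<lambda>x. ennreal (f x t))) H"
      by (simp add: emeasure_density)
    also have "\<dots> = emeasure (density (distr Q (vec_space A) \<pi>) (\<lambda>_. c)) H"
      using marginal unfolding A \<pi>_def[abs_def] by (simp only:)
    also have "\<dots> = c * emeasure Q {z\<in>space Q. \<pi> z \<in> H}"
      by (simp add: emeasure_density_const emeasure_distr vimage_def Int_def conj_commute)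
    finally show ?thesis .
  qed
  have AE_S: "AE x in \<nu>. x \<in> S \<or> f x t = 0"
  proof -
    \<comment> \<open>No mass of \<open>Q\<close> projects outside \<open>S\<close>, so by
      \<open>marg\<close> the integral of the nonnegative \<open>f x t\<close> there
      vanishes.\<close>
    have "AE z in Q. z \<notin> {z\<in>space Q. \<pi> z \<in> space (vec_space A) - S}"
      using S_AE by eventually_elim auto
    then have "emeasure Q {z\<in>space Q. \<pi> z \<in> space (vec_space A) - S} = 0"
      by (subst (asm) AE_iff_measurable[OF _ refl]) (auto cong: conj_cong)
    then have "(\<integral>\<^sup>+x. ennreal (f x t) * indicator (space (vec_space A) - S) x \<partial>\<nu>) = 0"
      by (subst marg) auto
    then have "AE x in \<nu>. ennreal (f x t) * indicator (space (vec_space A) - S) x = 0"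
      by (subst (asm) nn_integral_0_iff_AE) measurable
    then show ?thesis
      using AE_space
    proof eventually_elim
      case (elim x)
      then show ?case using f_nonneg[of x] by (auto simp: sp indicator_def split: if_splits)
    qed
  qed
  have Acc_measure: "measure (\<nu> \<Otimes>\<^sub>M Uni) (Acc \<inter> {w \<in> space (vec_space A \<Otimes>\<^sub>M borel). \<phi> (fst w) \<in> B}) = r / s * measure Q B"
    if B[measurable]: "B \<in> sets (vec_space {1..n})" for B
  proof -
    let ?W = "Acc \<inter> {w \<in> space (vec_space A \<Otimes>\<^sub>M borel). \<phi> (fst w) \<in> B}"
    let ?H = "{x \<in> space (vec_space A). x \<in> S \<and> \<phi> x \<in> B}"
    have "?W \<in> sets (vec_space A \<Otimes>\<^sub>M borel)" by measurable
    then have W: "?W \<in> sets (\<nu> \<Otimes>\<^sub>M Uni)" by measurable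
    have H: "?H \<in> sets (vec_space A)" by measurable
    have "emeasure (\<nu> \<Otimes>\<^sub>M Uni) ?W = (\<integral>\<^sup>+x. emeasure Uni (Pair x -` ?W) \<partial>\<nu>)"
      by (rule Uni.emeasure_pair_measure_alt[OF W])
    also have "\<dots> = (\<integral>\<^sup>+x. ennreal (1 / s) * (ennreal (f x t) * indicator ?H x) \<partial>\<nu>)"
    \<comment> \<open>For fixed \<open>x\<close> in \<open>S\<close>, the uniform variable accepts
      with probability exactly \<open>f x t / s\<close>, since this ratio lies between 0 and
      1.\<close>
    proof (rule nn_integral_cong)
      fix x assume "x \<in> space \<nu>"
      then have x: "x \<in> space (vec_space A)" by (simp add: sp)
      show "emeasure Uni (Pair x -` ?W) = ennreal (1 / s) * (ennreal (f x t) * indicator ?H x)"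
      proof (cases "x \<in> ?H")
        case True
        then have "x \<in> C" using S_sub C_image by auto
        then have "0 \<le> f x t / s" "f x t / s \<le> 1"
          using f_le[of x] s_pos f_nonneg[of x] x by auto
        moreover have "Pair x -` ?W = {u. u < f x t / s}"
          using True by (auto simp: Acc_def space_pair_measure)
        ultimately have "emeasure Uni (Pair x -` ?W) = ennreal (f x t / s)"
          by (simp only: Uni_def emeasure_uniform_unit_less)
        then show ?thesis
          using True s_pos f_nonneg[of x] x by (simp add: ennreal_mult[symmetric])
      next
        case False
        then have "Pair x -` ?W = {}" using x by (auto simp: Acc_def)
        then show ?thesis using False by simp
      qed
    qed
    also have "\<dots> = ennreal (1 / s) * (\<integral>\<^sup>+x. ennreal (f x t) * indicator ?H x \<partial>\<nu>)"
      by (rule nn_integral_cmult) measurable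
    also have "\<dots> = ennreal (1 / s) * (c * emeasure Q {z\<in>space Q. \<pi> z \<in> ?H})"
      by (simp only: marg[OF H])
    also have "emeasure Q {z\<in>space Q. \<pi> z \<in> ?H} = emeasure Q B"
    proof (rule emeasure_eq_AE)
      \<comment> \<open>Almost surely \<open>\<phi> (\<pi> z) = z\<close>, so testing the
        reconstructed vector for membership in \<open>B\<close> is testing \<open>z\<close>
        itself.\<close>
      show "AE z in Q. z \<in> {z\<in>space Q. \<pi> z \<in> ?H} \<longleftrightarrow> z \<in> B"
        using E_AE S_AE AE_space
      proof eventually_elim
        case (elim z)
        then show ?case
          using \<phi>_inv[of z] sets.sets_into_space[OF S] by auto
      qed
    qed measurable
    also have "ennreal (1 / s) * (c * emeasure Q B) = ennreal (r / s * measure Q B)"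
      using s_pos r by (simp add: Q.emeasure_eq_measure ennreal_mult[symmetric] field_simps)
    finally show ?thesis
      using s_pos r by (simp add: measure_def)
  qed
  have Acc_total: "measure (\<nu> \<Otimes>\<^sub>M Uni) Acc = r / s"
  proof -
    have "Acc \<inter> {w \<in> space (vec_space A \<Otimes>\<^sub>M borel). \<phi> (fst w) \<in> space (vec_space {1..n})} = Acc"
      using measurable_space[OF \<phi>] by (auto simp: Acc_def space_pair_measure)
    then show ?thesis
      using Acc_measure[OF sets.top] Q.prob_space by (simp add: sp)
  qed
  then have Acc_pos: "0 < measure (\<nu> \<Otimes>\<^sub>M Uni) Acc"
    using r s_pos by simp

  have Z_indep: "\<Omega>.indep_vars (\<lambda>_. vec_space A \<Otimes>\<^sub>M borel) Z UNIV"
    using indep unfolding A Z_def[abs_def] .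
  have Z_law: "distr \<Omega> (vec_space A \<Otimes>\<^sub>M borel) (Z k) = \<nu> \<Otimes>\<^sub>M Uni" for k
    using law[of k] unfolding A Z_def[abs_def] Uni_def .
  have Z[measurable]: "Z k \<in> \<Omega> \<rightarrow>\<^sub>M vec_space A \<Otimes>\<^sub>M borel" for k
    using Z_indep by (auto simp: \<Omega>.indep_vars_def)
  \<comment> \<open>Strict positivity of \<open>u\<close> matters: where \<open>f x t = 0\<close>
    the test \<open>u < 0\<close> fails, so points of \<open>C\<close> outside \<open>S\<close> are
    almost surely rejected.\<close>
  have "AE w in \<nu> \<Otimes>\<^sub>M Uni. (fst w \<in> S \<or> f (fst w) t = 0) \<and> 0 < snd w"
  proof (rule D.AE_pair_measure)
    have "AE u in Uni. 0 < u"
      unfolding Uni_def by (rule AE_uniform_measureI) auto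
    then show "AE x in \<nu>. AE u in Uni. (fst (x, u) \<in> S \<or> f (fst (x, u)) t = 0) \<and> 0 < snd (x, u)"
      using AE_S by auto
  qed measurable
  then have "AE \<omega> in \<Omega>. (fst (Z k \<omega>) \<in> S \<or> f (fst (Z k \<omega>)) t = 0) \<and> 0 < snd (Z k \<omega>)" for k
    unfolding Z_law[of k, symmetric] by (rule AE_distrD[OF Z])
  then have "AE \<omega> in \<Omega>. \<forall>k. (fst (Z k \<omega>) \<in> S \<or> f (fst (Z k \<omega>)) t = 0) \<and> 0 < snd (Z k \<omega>)"
    by (simp add: AE_all_countable)
  then have AE_acc: "AE \<omega> in \<Omega>. \<forall>k. accepts n T I f t (V k \<omega>) (U k \<omega>) \<longleftrightarrow> Z k \<omega> \<in> Acc"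
    using AE_space
  proof eventually_elim
    case (elim \<omega>)
    show ?case
    proof
      fix k
      have "Z k \<omega> \<in> space (vec_space A \<Otimes>\<^sub>M borel)"
        using measurable_space[OF Z elim(2)] .
      then show "accepts n T I f t (V k \<omega>) (U k \<omega>) \<longleftrightarrow> Z k \<omega> \<in> Acc"
        using elim(1)[rule_format, of k] S_sub C_image
        by (auto simp: accepts_iff Acc_def Z_def)
    qed
  qed
  have AE_ex: "AE \<omega> in \<Omega>. \<exists>k. Z k \<omega> \<in> Acc"
    by (rule \<Omega>.rejection_sampling_terminates[OF Z_indep Z_law Acc_sets Acc_pos])
  \<comment> \<open>A measurable version of the output, built from \<open>Acc\<close> and
    \<open>\<phi>\<close> instead of \<open>accepts\<close> and \<open>y_I\<close>.\<close>
  define g where "g \<omega> = \<phi> (fst (Z (LEAST k. Z k \<omega> \<in> Acc) \<omega>))" for \<omega>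
  have Z_least[measurable]: "(\<lambda>\<omega>. Z (LEAST k. Z k \<omega> \<in> Acc) \<omega>) \<in> \<Omega> \<rightarrow>\<^sub>M vec_space A \<Otimes>\<^sub>M borel"
    by (rule measurable_compose_countable) measurable
  have g[measurable]: "g \<in> \<Omega> \<rightarrow>\<^sub>M vec_space {1..n}"
    unfolding g_def by measurable
  have "distr \<Omega> (vec_space {1..n}) g = Q"
  proof (rule measure_eqI)
    fix B assume "B \<in> sets (distr \<Omega> (vec_space {1..n}) g)"
    then have B[measurable]: "B \<in> sets (vec_space {1..n})" by simp
    let ?B = "{w \<in> space (vec_space A \<Otimes>\<^sub>M borel). \<phi> (fst w) \<in> B}"
    have B': "?B \<in> sets (vec_space A \<Otimes>\<^sub>M borel)" by measurable
    have "g -` B \<inter> space \<Omega> = {\<omega>\<in>space \<Omega>. Z (LEAST k. Z k \<omega> \<in> Acc) \<omega> \<in> ?B}"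
      using measurable_space[OF Z] by (auto simp: g_def)
    then have "\<Omega>.prob (g -` B \<inter> space \<Omega>) = measure (\<nu> \<Otimes>\<^sub>M Uni) (Acc \<inter> ?B) / measure (\<nu> \<Otimes>\<^sub>M Uni) Acc"
      using \<Omega>.rejection_sampling_law[OF Z_indep Z_law Acc_sets Acc_pos B'] by simp
    also have "\<dots> = measure Q B"
      using Acc_measure[OF B] Acc_total r s_pos by simp
    finally show "emeasure (distr \<Omega> (vec_space {1..n}) g) B = emeasure Q B"
      by (simp add: emeasure_distr[OF g B] \<Omega>.emeasure_eq_measure Q.emeasure_eq_measure del: One_nat_def)
  qed (simp add: Q)
  moreover have "AE \<omega> in \<Omega>. pdc_output n T I f t V U \<omega> = g \<omega>"
    using AE_acc AE_ex
  proof eventually_elim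
    case (elim \<omega>)
    let ?k = "LEAST k. Z k \<omega> \<in> Acc"
    have "Z ?k \<omega> \<in> Acc" using elim(2) by (rule LeastI_ex)
    then have "V ?k \<omega> \<in> S" by (simp add: Acc_def Z_def)
    then show ?case
      using elim(1) sigma_\<phi> by (simp add: pdc_output_def g_def Z_def)
  qed
  \<comment> \<open>Transfer to the completion needs values in the right space at every point,
    including runs that never accept; gluing always yields an extensional vector.\<close>
  moreover have "pdc_output n T I f t V U \<in> space \<Omega> \<rightarrow> space (vec_space {1..n})"
    using sigma_I_space[OF I] by (auto simp: pdc_output_def Let_def)
  moreover have "AE \<omega> in \<Omega>. \<exists>k. accepts n T I f t (V k \<omega>) (U k \<omega>)"
    using AE_acc AE_ex by eventually_elim auto
  ultimately show ?thesis
    unfolding pdc_samples_from_def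
    using measurable_completion_AE_eq[OF g] distr_completion_AE_eq[OF g] by simp
qed

section \<open>The joint law of the first half and \<open>T\<close>\<close>

lemma measurable_sigma_I:
  assumes "I \<subseteq> {1..n}"
  shows "(\<lambda>(x, y). sigma_I n I x y) \<in> vec_space ({1..n} - I) \<Otimes>\<^sub>M vec_space I \<rightarrow>\<^sub>M vec_space {1..n}"
proof -
  have "{1..n} - I \<union> I = {1..n}" using assms by blast
  then have "merge ({1..n} - I) I \<in> vec_space ({1..n} - I) \<Otimes>\<^sub>M vec_space I \<rightarrow>\<^sub>M vec_space {1..n}"
    using measurable_merge[of "{1..n} - I" I "\<lambda>_. borel :: real measure"] by metis
  then show ?thesis
    unfolding sigma_I_def by (simp add: split_def)
qed

lemma sigma_I_subvec:
  assumes "I \<subseteq> {1..n}"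
  shows "sigma_I n I (subvec X ({1..n} - I) \<omega>) (subvec X I \<omega>) = subvec X {1..n} \<omega>"
  using assms by (auto simp: sigma_I_def merge_def subvec_def restrict_def fun_eq_iff)

text \<open>Independence of the coordinates makes the law of the two halves a product measure. Its
  section at a first half \<open>x\<close> in \<open>C\<close> is the event that \<open>T\<close> at
  \<open>x\<close> completed by the random second half lies in \<open>B\<close>, whose probability
  is the integral of \<open>f x\<close> over \<open>B\<close>.\<close>

lemma joint_law_conditional_density:
  fixes T :: "(nat \<Rightarrow> real) \<Rightarrow> 'b::euclidean_space"
  assumes M: "prob_space M"
    and indep: "prob_space.indep_vars M (\<lambda>_. borel) X {1..n}"
    and T[measurable]: "T \<in> borel_measurable (vec_space {1..n})"
    and I: "I \<subseteq> {1..n}"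
    and f: "conditional_density M n X T I f"
    and C: "C \<in> sets (vec_space ({1..n} - I))" and B: "B \<in> sets borel"
  shows "emeasure (distr M (vec_space {1..n}) (subvec X {1..n}))
      {z \<in> space (vec_space {1..n}). restrict z ({1..n} - I) \<in> C \<and> T z \<in> B} =
    (\<integral>\<^sup>+x\<in>C. (\<integral>\<^sup>+s\<in>B. ennreal (f x s) \<partial>lborel) \<partial>distr M (vec_space ({1..n} - I)) (subvec X ({1..n} - I)))"
proof -
  interpret M: prob_space M by fact
  define A where "A = {1..n} - I"
  note A = A_def[symmetric]
  note C[unfolded A, measurable] B[measurable]
  note measurable_sigma_I[OF I, unfolded A, measurable]
  have X: "X i \<in> borel_measurable M" if "i \<in> {1..n}" for i
    using indep that by (auto simp: M.indep_vars_def)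
  have sv: "subvec X K \<in> M \<rightarrow>\<^sub>M vec_space K" if "K \<subseteq> {1..n}" for K
    unfolding subvec_def using X that by (intro measurable_restrict) auto
  have AI: "A \<subseteq> {1..n}" "A \<inter> I = {}" by (auto simp: A_def)
  note sv[OF order_refl, measurable] sv[OF AI(1), measurable] sv[OF I, measurable]
  have [measurable]: "(\<lambda>z. restrict z A) \<in> vec_space {1..n} \<rightarrow>\<^sub>M vec_space A"
    using AI(1) by (rule measurable_restrict_subset)
  let ?\<mu>1 = "distr M (vec_space A) (subvec X A)" and ?\<mu>2 = "distr M (vec_space I) (subvec X I)"
  interpret \<mu>1: prob_space ?\<mu>1 by (rule M.prob_space_distr) measurable
  interpret \<mu>2: prob_space ?\<mu>2 by (rule M.prob_space_distr) measurable
  have "M.indep_var (vec_space A) (subvec X A) (vec_space I) (subvec X I)"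
    using M.indep_var_restrict[OF indep AI(2,1) I] by (simp add: subvec_def[abs_def])
  then have prod: "?\<mu>1 \<Otimes>\<^sub>M ?\<mu>2 = distr M (vec_space A \<Otimes>\<^sub>M vec_space I) (\<lambda>\<omega>. (subvec X A \<omega>, subvec X I \<omega>))"
    by (simp add: M.indep_var_distribution_eq)
  let ?W = "{w \<in> space (vec_space A \<Otimes>\<^sub>M vec_space I). fst w \<in> C \<and> T (case w of (x, y) \<Rightarrow> sigma_I n I x y) \<in> B}"
  have W: "?W \<in> sets (vec_space A \<Otimes>\<^sub>M vec_space I)" by measurable
  have restr: "restrict (subvec X {1..n} \<omega>) A = subvec X A \<omega>" for \<omega>
    using AI(1) by (auto simp: subvec_def restrict_def fun_eq_iff)
  have "emeasure (distr M (vec_space {1..n}) (subvec X {1..n})) {z \<in> space (vec_space {1..n}). restrict z A \<in> C \<and> T z \<in> B}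
      = emeasure M (subvec X {1..n} -` {z \<in> space (vec_space {1..n}). restrict z A \<in> C \<and> T z \<in> B} \<inter> space M)"
    by (rule emeasure_distr) measurable
  \<comment> \<open>Gluing the halves back together expresses the event through the pair whose law
    is the product measure.\<close>
  also have "subvec X {1..n} -` {z \<in> space (vec_space {1..n}). restrict z A \<in> C \<and> T z \<in> B} \<inter> space M =
      (\<lambda>\<omega>. (subvec X A \<omega>, subvec X I \<omega>)) -` ?W \<inter> space M"
    using measurable_space[OF sv[OF order_refl]] measurable_space[OF sv[OF AI(1)]] measurable_space[OF sv[OF I]]
      sigma_I_subvec[OF I, of X, unfolded A]
    by (auto simp: restr space_pair_measure simp del: One_nat_def)
  also have "emeasure M \<dots> = emeasure (?\<mu>1 \<Otimes>\<^sub>M ?\<mu>2) ?W"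
    unfolding prod by (rule emeasure_distr[symmetric]) (use W in measurable)
  also have "\<dots> = (\<integral>\<^sup>+x. emeasure ?\<mu>2 (Pair x -` ?W) \<partial>?\<mu>1)"
    using W by (intro \<mu>2.emeasure_pair_measure_alt) (simp cong: sets_pair_measure_cong)
  also have "\<dots> = (\<integral>\<^sup>+x\<in>C. (\<integral>\<^sup>+s\<in>B. ennreal (f x s) \<partial>lborel) \<partial>?\<mu>1)"
  proof (rule nn_integral_cong)
    fix x assume "x \<in> space ?\<mu>1"
    then have x: "x \<in> space (vec_space A)" by simp
    show "emeasure ?\<mu>2 (Pair x -` ?W) = (\<integral>\<^sup>+s\<in>B. ennreal (f x s) \<partial>lborel) * indicator C x"
    proof (cases "x \<in> C")
      case True
      let ?Y = "\<lambda>\<omega>. T (sigma_I n I x (subvec X I \<omega>))"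
      have dist: "distributed M lborel ?Y (\<lambda>s. ennreal (f x s))"
        using f x unfolding conditional_density_def A by blast
      have "Pair x -` ?W \<in> sets (vec_space I)"
        using W by (rule sets_Pair1)
      then have "emeasure ?\<mu>2 (Pair x -` ?W) = emeasure M (subvec X I -` (Pair x -` ?W) \<inter> space M)"
        by (intro emeasure_distr) measurable
      also have "subvec X I -` (Pair x -` ?W) \<inter> space M = ?Y -` B \<inter> space M"
        using True x measurable_space[OF sv[OF I]] by (auto simp: space_pair_measure)
      also have "emeasure M \<dots> = (\<integral>\<^sup>+s\<in>B. ennreal (f x s) \<partial>lborel)"
        using dist by (rule distributed_emeasure) simp
      finally show ?thesis using True by simp
    next
      case False
      then have "Pair x -` ?W = {}" by auto
      then show ?thesis using False by simp
    qed
  qed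
  finally show ?thesis unfolding A .
qed

theorem theorem4p2:
  fixes M :: "'a measure" and n :: nat and X :: "nat \<Rightarrow> 'a \<Rightarrow> real"
    and T :: "(nat \<Rightarrow> real) \<Rightarrow> 'b::euclidean_space" and I :: "nat set"
    and f :: "(nat \<Rightarrow> real) \<Rightarrow> 'b \<Rightarrow> real"
    and P :: "'b \<Rightarrow> (nat \<Rightarrow> real) measure"
  assumes "prob_space M"
    and "prob_space.indep_vars M (\<lambda>_. borel) X {1..n}"
    and "\<forall>j\<in>{1..n}. continuous_rv M (X j)"
    and "T \<in> borel_measurable (vec_space {1..n})"
    and "continuous_rv M (\<lambda>\<omega>. T (subvec X {1..n} \<omega>))"
    and "I \<subseteq> {1..n}"
    and "conditional_density M n X T I f"
    and "disintegration (distr M (vec_space {1..n}) (subvec X {1..n})) T P"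
  shows "AE t in distr M borel (\<lambda>\<omega>. T (subvec X {1..n} \<omega>)).
    t \<in> T ` space (vec_space {1..n}) \<and> DSH n T I t \<and> A1 n T I f t \<and> A2 M n X T I f t \<longrightarrow>
    (\<forall>(\<Omega> :: 'd measure) V U. fresh_draws M n X I \<Omega> V U \<longrightarrow>
       pdc_samples_from n T I f t \<Omega> V U (P t))"
proof -
  interpret M: prob_space M by fact
  note T = assms(4) and I = assms(6) and P = assms(8)
  have X: "X i \<in> borel_measurable M" if "i \<in> {1..n}" for i
    using assms(2) that by (auto simp: M.indep_vars_def)
  have sv: "subvec X K \<in> M \<rightarrow>\<^sub>M vec_space K" if "K \<subseteq> {1..n}" for K
    unfolding subvec_def using X that by (intro measurable_restrict) auto
  let ?A = "{1..n} - I"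
  let ?\<mu> = "distr M (vec_space {1..n}) (subvec X {1..n})"
  let ?\<nu> = "distr M (vec_space ?A) (subvec X ?A)"
  have A_sub: "?A \<subseteq> {1..n}" by blast
  have \<mu>: "prob_space ?\<mu>" and \<nu>: "prob_space ?\<nu>"
    by (intro M.prob_space_distr sv order_refl A_sub)+
  have T\<mu>: "T \<in> borel_measurable ?\<mu>" using T by simp
  have T_law: "distr M borel (\<lambda>\<omega>. T (subvec X {1..n} \<omega>)) = distr ?\<mu> borel T"
    using distr_distr[OF T sv[OF order_refl]] by (simp add: comp_def)
  obtain g where g: "distributed M lborel (\<lambda>\<omega>. T (subvec X {1..n} \<omega>)) g"
    using assms(5) by (auto simp: continuous_rv_def)
  \<comment> \<open>\<open>borel\<close> and \<open>lborel\<close> have the same measurable sets, so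
    the choice of target does not change the law.\<close>
  have "distr M borel (\<lambda>\<omega>. T (subvec X {1..n} \<omega>)) = distr M lborel (\<lambda>\<omega>. T (subvec X {1..n} \<omega>))"
    by (rule distr_cong) auto
  with g have Tg: "distr ?\<mu> borel T = density lborel g"
    unfolding T_law[symmetric] by (simp add: distributed_distr_eq_density)
  have g_meas: "g \<in> borel_measurable borel"
    using distributed_borel_measurable[OF g] by simp
  have f_meas: "(\<lambda>(x, s). f x s) \<in> borel_measurable (vec_space ?A \<Otimes>\<^sub>M borel)"
    and f_nonneg: "\<And>x s. x \<in> space (vec_space ?A) \<Longrightarrow> 0 \<le> f x s"
    using assms(7) unfolding conditional_density_def by blast+
  have f_meas': "(\<lambda>(x, s). ennreal (f x s)) \<in> borel_measurable (vec_space ?A \<Otimes>\<^sub>M borel)"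
    using measurable_compose[OF f_meas measurable_ennreal] by (simp add: split_def)
  have restr: "(\<lambda>z. restrict z ?A) \<in> ?\<mu> \<rightarrow>\<^sub>M vec_space ?A"
    using measurable_restrict_subset[OF A_sub] by simp
  obtain G where G: "countable G" "Int_stable G" "sets (vec_space ?A) = sigma_sets (space (vec_space ?A)) G"
    "space (vec_space ?A) \<in> G" "G \<subseteq> Pow (space (vec_space ?A))"
    by (rule countable_generator_vec_space)
  have joint: "emeasure ?\<mu> {z \<in> space ?\<mu>. restrict z ?A \<in> C \<and> T z \<in> B} =
      (\<integral>\<^sup>+x\<in>C. (\<integral>\<^sup>+s\<in>B. ennreal (f x s) \<partial>lborel) \<partial>?\<nu>)"
    if "C \<in> sets (vec_space ?A)" "B \<in> sets borel" for C B
    unfolding space_distr using that by (rule joint_law_conditional_density[OF assms(1,2,4,6,7)])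
  have marginal: "AE t in distr ?\<mu> borel T.
      density (distr (P t) (vec_space ?A) (\<lambda>z. restrict z ?A)) (\<lambda>_. g t) = density ?\<nu> (\<lambda>x. ennreal (f x t))"
    "AE t in distr ?\<mu> borel T. 0 < g t \<and> g t < \<infinity>"
    by (rule disintegration_marginal[OF \<mu> T\<mu> P restr G prob_space_imp_sigma_finite[OF \<nu>] sets_distr f_meas' joint g_meas Tg];
      assumption)+
  have "AE t in distr ?\<mu> borel T. emeasure (P t) {z \<in> space ?\<mu>. T z \<noteq> t} = 0"
    using P unfolding disintegration_def by blast
  \<comment> \<open>The three almost sure facts do not mention \<Omega>, \<open>V\<close> or
    \<open>U\<close>, so a single null set of \<open>t\<close> serves all runs of the
    algorithm.\<close>
  with marginal show ?thesis
    unfolding T_law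
  proof eventually_elim
    case (elim t)
    show ?case
    proof (intro impI allI)
      fix \<Omega> :: "'d measure" and V U
      assume asm: "t \<in> T ` space (vec_space {1..n}) \<and> DSH n T I t \<and> A1 n T I f t \<and> A2 M n X T I f t"
        and fresh: "fresh_draws M n X I \<Omega> V U"
      have Pt: "prob_space (P t)" "sets (P t) = sets (vec_space {1..n})"
        using P unfolding disintegration_def by (simp_all del: One_nat_def)
      have Pt_space: "space (P t) = space (vec_space {1..n})"
        using Pt(2) by (rule sets_eq_imp_space_eq)
      have "{z \<in> space (vec_space {1..n}). T z \<noteq> t} \<in> sets (P t)"
        unfolding Pt(2) using T by measurable
      then have "AE z in P t. z \<notin> {z \<in> space (vec_space {1..n}). T z \<noteq> t}"
        using elim(3) by (intro AE_not_in null_setsI) (auto simp del: One_nat_def)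
      then have fibre: "AE z in P t. T z = t"
        using AE_space by eventually_elim (auto simp: Pt_space)
      have ft: "(\<lambda>x. f x t) \<in> borel_measurable (vec_space ?A)"
        using measurable_compose[OF measurable_Pair2'[of t borel] f_meas] by simp
      show "pdc_samples_from n T I f t \<Omega> V U (P t)"
      proof (rule pdc_samples_fromI[where f = f and t = t and c = "g t", OF I T \<nu> sets_distr Pt fibre ft])
        show "0 \<le> f x t" if "x \<in> space (vec_space ?A)" for x using that by (rule f_nonneg)
      qed (use elim(1,2) asm fresh in \<open>unfold fresh_draws_def, blast+\<close>)
    qed
  qed
qed

end
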